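(* Let $\mathrm{IDB}$ denote the identifier-based bucketization, in which the bucket of a credential $(u,w)\in\mathcal{U}\times\mathcal{W}$ is $H^{(l)}(u)$. Then for all $q\ge 0$, $$\mathsf{Adv}^{\mathsf{b\text{-}gs}}_{\mathrm{IDB}}(q)=\mathsf{Adv}^{\mathsf{gs}}(q).$$
   Context: $\mathcal{U}$ is the set of usernames, $\mathcal{W}$ the set of passwords, and $p$ a (discrete) probability distribution on $\mathcal{U}\times\mathcal{W}$. $H\colon\{0,1\}^*\to\{0,1\}^{\ell}$ is a fixed (hash) function, and $H^{(l)}(u)$ denotes the $l$-bit prefix of $H(u)$. The set of buckets is $\mathcal{B}=\{0,1\}^l$. Credentials are username-password pairs $s=(u,w)$. A bucketizing function is a map $\beta$ from credentials to nonempty subsets of $\mathcal{B}$; for identifier-based bucketization (IDB), $\beta((u,w))=\{H^{(l)}(u)\}$, so the bucket depends only on the username. Game $\mathsf{Guess}^{\mathcal{A}}(q)$: draw $(u,w)$ from $p$; the adversary $\mathcal{A}$ receives $(u,q)$ and outputs a set of (at most) $q$ passwords; the game outputs 1 iff $w$ is in that set. Game $\mathsf{BucketGuess}_{\beta}^{\mathcal{A}'}(q)$: draw $(u,w)$ from $p$, draw $b$ uniformly at random from $\beta((u,w))$; the adversary $\mathcal{A}'$ receives $(u,b,q)$ and outputs a set of (at most) $q$ passwords; the game outputs 1 iff $w$ is in that set. Adversaries are computationally unbounded and know $p$ and $\beta$. The advantages are $\mathsf{Adv}^{\mathsf{gs}}(q)=\max_{\mathcal{A}}\Pr[\mathsf{Guess}^{\mathcal{A}}(q)\Rightarrow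 1]$ and $\mathsf{Adv}^{\mathsf{b\text{-}gs}}_{\beta}(q)=\max_{\mathcal{A}'}\Pr[\mathsf{BucketGuess}^{\mathcal{A}'}_{\beta}(q)\Rightarrow 1]$; $\mathsf{Adv}^{\mathsf{b\text{-}gs}}_{\mathrm{IDB}}$ is the latter with $\beta$ the IDB bucketizing function. *)

theory Defs
  imports "HOL-Probability.Probability"
begin

text \<open>Usernames are bit strings, since the hash function is applied to them; buckets are bit
  strings of length \<open>l\<close>; the type of passwords is arbitrary.\<close>

type_synonym bits = "bool list"
type_synonym 'w cred = "bits \<times> 'w"

definition buckets :: "nat \<Rightarrow> bits set" where
  "buckets l = {b. length b = l}"

definition hash_prefix :: "(bits \<Rightarrow> bits) \<Rightarrow> nat \<Rightarrow> bits \<Rightarrow> bits" where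
  "hash_prefix H l u = take l (H u)"

definition bucketizing :: "bits set \<Rightarrow> 'w set \<Rightarrow> nat \<Rightarrow> ('w cred \<Rightarrow> bits set) \<Rightarrow> bool" where
  "bucketizing U W l \<beta> \<longleftrightarrow> (\<forall>s \<in> U \<times> W. \<beta> s \<noteq> {} \<and> \<beta> s \<subseteq> buckets l)"

definition IDB :: "(bits \<Rightarrow> bits) \<Rightarrow> nat \<Rightarrow> 'w cred \<Rightarrow> bits set" where
  "IDB H l = (\<lambda>(u, w). {hash_prefix H l u})"

definition guess_sets :: "'w set \<Rightarrow> nat \<Rightarrow> 'w set set" where
  "guess_sets W q = {S. S \<subseteq> W \<and> finite S \<and> card S \<le> q}"

text \<open>Adversaries are unbounded: arbitrary, possibly randomized, functions of their inputs.
  Knowledge of the distribution and of the bucketizing function is implicit, since the maxima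
  below are taken for fixed \<open>p\<close> and \<open>\<beta>\<close>.\<close>

type_synonym 'w guess_adv = "bits \<Rightarrow> nat \<Rightarrow> 'w set pmf"
type_synonym 'w bguess_adv = "bits \<Rightarrow> bits \<Rightarrow> nat \<Rightarrow> 'w set pmf"

definition guess_adversary :: "bits set \<Rightarrow> 'w set \<Rightarrow> 'w guess_adv \<Rightarrow> bool" where
  "guess_adversary U W A \<longleftrightarrow> (\<forall>u\<in>U. \<forall>q. set_pmf (A u q) \<subseteq> guess_sets W q)"

definition bguess_adversary :: "bits set \<Rightarrow> 'w set \<Rightarrow> nat \<Rightarrow> 'w bguess_adv \<Rightarrow> bool" where
  "bguess_adversary U W l A \<longleftrightarrow>
     (\<forall>u\<in>U. \<forall>b\<in>buckets l. \<forall>q. set_pmf (A u b q) \<subseteq> guess_sets W q)"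

definition Guess :: "'w cred pmf \<Rightarrow> 'w guess_adv \<Rightarrow> nat \<Rightarrow> bool pmf" where
  "Guess p A q = do {
     (u, w) \<leftarrow> p;
     S \<leftarrow> A u q;
     return_pmf (w \<in> S)
   }"

definition BucketGuess ::
  "'w cred pmf \<Rightarrow> ('w cred \<Rightarrow> bits set) \<Rightarrow> 'w bguess_adv \<Rightarrow> nat \<Rightarrow> bool pmf" where
  "BucketGuess p \<beta> A q = do {
     (u, w) \<leftarrow> p;
     b \<leftarrow> pmf_of_set (\<beta> (u, w));
     S \<leftarrow> A u b q;
     return_pmf (w \<in> S)
   }"

text \<open>The advantages are maxima, rendered with \<^const>\<open>Greatest\<close>; the lemmas \<open>adv_gs_attained\<close> and
  \<open>adv_bgs_attained\<close> below show that these maxima exist.\<close>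

definition adv_gs :: "bits set \<Rightarrow> 'w set \<Rightarrow> 'w cred pmf \<Rightarrow> nat \<Rightarrow> real" where
  "adv_gs U W p q = (GREATEST x. \<exists>A. guess_adversary U W A \<and> x = pmf (Guess p A q) True)"

definition adv_bgs ::
  "bits set \<Rightarrow> 'w set \<Rightarrow> 'w cred pmf \<Rightarrow> nat \<Rightarrow> ('w cred \<Rightarrow> bits set) \<Rightarrow> nat \<Rightarrow> real" where
  "adv_bgs U W p l \<beta> q =
     (GREATEST x. \<exists>A. bguess_adversary U W l A \<and> x = pmf (BucketGuess p \<beta> A q) True)"

lemma IDB_bucketizing:
  assumes "\<forall>x. length (H x) = ell" "l \<le> ell"
  shows "bucketizing U W l (IDB H l)"
  using assms by (auto simp: bucketizing_def IDB_def hash_prefix_def buckets_def)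


subsection \<open>Existence of the maxima\<close>

lemma best_guess_set:
  fixes f :: "'w \<Rightarrow> real"
  assumes nn: "\<And>w. f w \<ge> 0" and lev: "\<And>e. e > 0 \<Longrightarrow> finite {w. f w \<ge> e}"
  shows "\<exists>S \<in> guess_sets W q. \<forall>T \<in> guess_sets W q. sum f T \<le> sum f S"
proof (induction q arbitrary: W)
  case 0
  show ?case by (rule bexI[of _ "{}"]) (auto simp: guess_sets_def)
next
  case (Suc q)
  show ?case
  proof (cases "\<exists>w\<in>W. f w > 0")
    case False
    then have z: "\<And>w. w \<in> W \<Longrightarrow> f w = 0" using nn by (metis order_le_less)
    show ?thesis
      by (rule bexI[of _ "{}"]) (auto simp: guess_sets_def z subset_iff intro!: sum_nonpos)
  next
    case True
    then obtain w0 where w0: "w0 \<in> W" "f w0 > 0" by blast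
    define L where "L = {w\<in>W. f w \<ge> f w0}"
    have L: "finite L" "w0 \<in> L"
      using lev[OF w0(2)] w0 by (auto simp: L_def intro: finite_subset)
    have "Max (f ` L) \<in> f ` L" using L by (intro Max_in) auto
    then obtain m where m: "m \<in> L" "Max (f ` L) = f m" by (rule imageE) auto
    have mL: "f w \<le> f m" if "w \<in> L" for w
      using Max_ge[of "f ` L" "f w"] L(1) that m(2) by simp
    have mW: "m \<in> W" using m(1) by (simp add: L_def)
    have mx: "f w \<le> f m" if "w \<in> W" for w
    proof (cases "w \<in> L")
      case False
      then have "f w \<le> f w0" using that by (simp add: L_def)
      then show ?thesis using mL[OF L(2)] by simp
    qed (rule mL)
    obtain S where S: "S \<in> guess_sets (W - {m}) q"
      "\<And>T. T \<in> guess_sets (W - {m}) q \<Longrightarrow> sum f T \<le> sum f S" using Suc by blast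
    have fS: "finite S" "m \<notin> S" using S(1) by (auto simp: guess_sets_def)
    have "sum f T \<le> sum f (insert m S)" if T: "T \<in> guess_sets W (Suc q)" for T
    proof (cases "T = {}")
      case True
      then show ?thesis by (simp add: sum_nonneg nn)
    next
      case False
      define t where "t = (if m \<in> T then m else SOME t. t \<in> T)"
      have t: "t \<in> T" using False by (auto simp: t_def some_in_eq)
      have fT: "finite T" "T \<subseteq> W" "card T \<le> Suc q" using T by (auto simp: guess_sets_def)
      have "T - {t} \<in> guess_sets (W - {m}) q"
        using fT t by (auto simp: guess_sets_def t_def card_Diff_singleton_if split: if_splits)
      then have "sum f (T - {t}) \<le> sum f S" by (rule S(2))
      moreover have "f t \<le> f m" using t fT mx by auto
      moreover have "sum f T = f t + sum f (T - {t})" using fT t by (simp add: sum.remove)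
      ultimately show ?thesis using fS by simp
    qed
    moreover have "insert m S \<in> guess_sets W (Suc q)"
      using S(1) fS mW by (auto simp: guess_sets_def)
    ultimately show ?thesis by blast
  qed
qed

text \<open>Both games are instances of guessing \<open>w\<close> from a view \<open>x\<close>, with \<open>(x, w)\<close> drawn from a joint
  distribution \<open>J\<close>.\<close>

lemma pmf_level_finite:
  assumes "e > 0"
  shows "finite {w. pmf J (x, w) \<ge> e}"
proof (rule ccontr)
  assume inf: "infinite {w. pmf J (x, w) \<ge> e}"
  obtain n :: nat where n: "1 < real n * e" using assms reals_Archimedean3 by blast
  obtain T where T: "T \<subseteq> {w. pmf J (x, w) \<ge> e}" "finite T" "card T = n"
    using inf infinite_arbitrarily_large by blast
  have "real n * e \<le> (\<Sum>w\<in>T. pmf J (x, w))"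
    using sum_mono[of T "\<lambda>_. e" "\<lambda>w. pmf J (x, w)"] T by auto
  also have "\<dots> = sum (pmf J) (Pair x ` T)"
    by (subst sum.reindex) (auto simp: inj_on_def)
  also have "\<dots> = measure (measure_pmf J) (Pair x ` T)"
    using T by (simp add: measure_measure_pmf_finite)
  also have "\<dots> \<le> 1" by simp
  finally show False using n by simp
qed

lemma best_strategy:
  fixes J :: "('x \<times> 'w) pmf"
  shows "\<exists>B :: 'x \<Rightarrow> nat \<Rightarrow> 'w set. (\<forall>x q. B x q \<in> guess_sets W q) \<and>
    (\<forall>A q. (\<forall>x w. (x, w) \<in> set_pmf J \<longrightarrow> set_pmf (A x) \<subseteq> guess_sets W q) \<longrightarrow>
       pmf (J \<bind> (\<lambda>(x, w). A x \<bind> (\<lambda>S. return_pmf (w \<in> S)))) True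
       \<le> pmf (J \<bind> (\<lambda>(x, w). return_pmf (w \<in> B x q))) True)"
proof -
  define ok where "ok x q S \<longleftrightarrow> S \<in> guess_sets W q \<and>
    (\<forall>T \<in> guess_sets W q. (\<Sum>w\<in>T. pmf J (x, w)) \<le> (\<Sum>w\<in>S. pmf J (x, w)))" for x q S
  define B where "B x q = (SOME S. ok x q S)" for x q
  have "\<exists>S \<in> guess_sets W q. \<forall>T \<in> guess_sets W q.
      (\<Sum>w\<in>T. pmf J (x, w)) \<le> (\<Sum>w\<in>S. pmf J (x, w))" for x q
    by (rule best_guess_set) (auto intro: pmf_level_finite)
  then have "\<exists>S. ok x q S" for x q by (simp add: ok_def Bex_def)
  then have "ok x q (B x q)" for x q unfolding B_def by (rule someI_ex)
  then have B: "\<And>x q. B x q \<in> guess_sets W q"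
    "\<And>x q T. T \<in> guess_sets W q \<Longrightarrow> (\<Sum>w\<in>T. pmf J (x, w)) \<le> (\<Sum>w\<in>B x q. pmf J (x, w))"
    by (simp_all add: ok_def)
  show ?thesis
  proof (intro exI[of _ B] conjI allI impI)
    fix A :: "'x \<Rightarrow> 'w set pmf" and q
    assume A: "\<forall>x w. (x, w) \<in> set_pmf J \<longrightarrow> set_pmf (A x) \<subseteq> guess_sets W q"
    have fin: "(\<integral>\<^sup>+w. ennreal (pmf J (x, w)) * indicator S w \<partial>count_space UNIV)
        = ennreal (\<Sum>w\<in>S. pmf J (x, w))" if "finite S" for S x
    proof -
      have "(\<integral>\<^sup>+w. ennreal (pmf J (x, w)) * indicator S w \<partial>count_space UNIV)
        = (\<integral>\<^sup>+w. ennreal (pmf J (x, w)) \<partial>count_space S)"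
        by (simp add: nn_integral_count_space_indicator)
      then show ?thesis using that by (simp add: nn_integral_count_space_finite)
    qed
    have val: "ennreal (pmf (J \<bind> (\<lambda>(x, w). C x \<bind> (\<lambda>S. return_pmf (w \<in> S)))) True)
      = (\<integral>\<^sup>+x. \<integral>\<^sup>+S. (\<integral>\<^sup>+w. ennreal (pmf J (x, w)) * indicator S w \<partial>count_space UNIV)
           \<partial>measure_pmf (C x) \<partial>count_space UNIV)" for C :: "'x \<Rightarrow> 'w set pmf"
    proof -
      have ind: "ennreal (indicat_real {True} (w \<in> S)) = indicator S w" for w :: 'w and S
        by (auto simp: indicator_def)
      have "ennreal (pmf (J \<bind> (\<lambda>(x, w). C x \<bind> (\<lambda>S. return_pmf (w \<in> S)))) True)
        = (\<integral>\<^sup>+z. ennreal (pmf J z) *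
             (\<integral>\<^sup>+S. indicator S (snd z) \<partial>measure_pmf (C (fst z))) \<partial>count_space UNIV)"
        by (simp add: ennreal_pmf_bind nn_integral_measure_pmf[of J] case_prod_beta ind)
      also have "\<dots> = (\<integral>\<^sup>+x. \<integral>\<^sup>+w. ennreal (pmf J (x, w)) *
             (\<integral>\<^sup>+S. indicator S w \<partial>measure_pmf (C x)) \<partial>count_space UNIV \<partial>count_space UNIV)"
        by (subst nn_integral_fst_count_space[symmetric]) simp
      also have "\<dots> = (\<integral>\<^sup>+x. \<integral>\<^sup>+w. \<integral>\<^sup>+S. ennreal (pmf (C x) S) *
             (ennreal (pmf J (x, w)) * indicator S w)
             \<partial>count_space UNIV \<partial>count_space UNIV \<partial>count_space UNIV)"
        by (simp add: nn_integral_measure_pmf nn_integral_cmult[symmetric] mult_ac)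
      also have "\<dots> = (\<integral>\<^sup>+x. \<integral>\<^sup>+S. \<integral>\<^sup>+w. ennreal (pmf (C x) S) *
             (ennreal (pmf J (x, w)) * indicator S w)
             \<partial>count_space UNIV \<partial>count_space UNIV \<partial>count_space UNIV)"
      proof (rule nn_integral_cong)
        fix x
        define g where "g = (\<lambda>(w, S). ennreal (pmf (C x) S) *
             (ennreal (pmf J (x, w)) * indicator S w))"
        show "(\<integral>\<^sup>+w. \<integral>\<^sup>+S. ennreal (pmf (C x) S) *
             (ennreal (pmf J (x, w)) * indicator S w) \<partial>count_space UNIV \<partial>count_space UNIV)
          = (\<integral>\<^sup>+S. \<integral>\<^sup>+w. ennreal (pmf (C x) S) *
             (ennreal (pmf J (x, w)) * indicator S w) \<partial>count_space UNIV \<partial>count_space UNIV)"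
          using nn_integral_fst_count_space[of g] nn_integral_snd_count_space[of g]
          by (simp add: g_def)
      qed
      also have "\<dots> = (\<integral>\<^sup>+x. \<integral>\<^sup>+S. (\<integral>\<^sup>+w. ennreal (pmf J (x, w)) * indicator S w
           \<partial>count_space UNIV) \<partial>measure_pmf (C x) \<partial>count_space UNIV)"
        by (simp add: nn_integral_measure_pmf nn_integral_cmult)
      finally show ?thesis .
    qed
    have "ennreal (pmf (J \<bind> (\<lambda>(x, w). A x \<bind> (\<lambda>S. return_pmf (w \<in> S)))) True)
      \<le> ennreal (pmf (J \<bind> (\<lambda>(x, w). return_pmf (B x q) \<bind> (\<lambda>S. return_pmf (w \<in> S)))) True)"
      unfolding val
    proof (rule nn_integral_mono)
      fix x
      let ?I = "\<lambda>S. \<integral>\<^sup>+w. ennreal (pmf J (x, w)) * indicator S w \<partial>count_space UNIV"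
      have "(\<integral>\<^sup>+S. ?I S \<partial>measure_pmf (A x)) \<le> ?I (B x q)"
      proof (cases "\<exists>w. (x, w) \<in> set_pmf J")
        case True
        then have "?I S \<le> ?I (B x q)" if "S \<in> set_pmf (A x)" for S
        proof -
          have S: "S \<in> guess_sets W q" using A that True by blast
          then have "finite S" "finite (B x q)" using B(1)[of x q] by (auto simp: guess_sets_def)
          then show ?thesis using B(2)[OF S, of x] by (simp add: fin ennreal_leI)
        qed
        then have "(\<integral>\<^sup>+S. ?I S \<partial>measure_pmf (A x)) \<le> (\<integral>\<^sup>+S. ?I (B x q) \<partial>measure_pmf (A x))"
          by (intro nn_integral_mono_AE) (simp add: AE_measure_pmf_iff)
        then show ?thesis by simp
      next
        case False
        then have "\<And>w. pmf J (x, w) = 0" by (simp add: set_pmf_iff)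
        then show ?thesis by simp
      qed
      then show "(\<integral>\<^sup>+S. ?I S \<partial>measure_pmf (A x)) \<le>
          (\<integral>\<^sup>+S. ?I S \<partial>measure_pmf (return_pmf (B x q)))" by simp
    qed
    then show "pmf (J \<bind> (\<lambda>(x, w). A x \<bind> (\<lambda>S. return_pmf (w \<in> S)))) True
       \<le> pmf (J \<bind> (\<lambda>(x, w). return_pmf (w \<in> B x q))) True"
      by (simp add: bind_return_pmf)
  qed (rule B(1))
qed

lemma Greatest_attained:
  fixes f :: "'a \<Rightarrow> real"
  assumes "P a" "\<And>b. P b \<Longrightarrow> f b \<le> f a"
  shows "(GREATEST x. \<exists>b. P b \<and> x = f b) = f a"
  by (rule Greatest_equality) (use assms in auto)

lemma adv_gs_attained:
  assumes "set_pmf p \<subseteq> U \<times> W"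
  obtains A where "guess_adversary U W A" "adv_gs U W p q = pmf (Guess p A q) True"
    "\<And>A'. guess_adversary U W A' \<Longrightarrow> pmf (Guess p A' q) True \<le> adv_gs U W p q"
proof -
  obtain B where B1: "\<forall>x q. B x q \<in> guess_sets W q" and
    B2: "\<forall>A q. (\<forall>x w. (x, w) \<in> set_pmf p \<longrightarrow> set_pmf (A x) \<subseteq> guess_sets W q) \<longrightarrow>
       pmf (p \<bind> (\<lambda>(x, w). A x \<bind> (\<lambda>S. return_pmf (w \<in> S)))) True
       \<le> pmf (p \<bind> (\<lambda>(x, w). return_pmf (w \<in> B x q))) True"
    using best_strategy[of W p] by (elim exE conjE) (rule that)
  note B = B1 B2[THEN spec, THEN spec, THEN mp]
  let ?A = "\<lambda>u q. return_pmf (B u q)"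
  have A: "guess_adversary U W ?A" using B(1) by (auto simp: guess_adversary_def)
  have le: "pmf (Guess p A' q) True \<le> pmf (Guess p ?A q) True" if "guess_adversary U W A'" for A'
  proof -
    have "\<forall>x w. (x, w) \<in> set_pmf p \<longrightarrow> set_pmf (A' x q) \<subseteq> guess_sets W q"
      using assms that unfolding guess_adversary_def by blast
    from B(2)[of "\<lambda>u. A' u q" q, OF this] show ?thesis
      by (simp add: Guess_def bind_return_pmf)
  qed
  have "adv_gs U W p q = pmf (Guess p ?A q) True"
    unfolding adv_gs_def by (rule Greatest_attained) (use A le in auto)
  then show thesis using that A le by metis
qed

lemma adv_bgs_attained:
  assumes "set_pmf p \<subseteq> U \<times> W" "bucketizing U W l \<beta>"
  obtains A where "bguess_adversary U W l A" "adv_bgs U W p l \<beta> q = pmf (BucketGuess p \<beta> A q) True"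
    "\<And>A'. bguess_adversary U W l A' \<Longrightarrow> pmf (BucketGuess p \<beta> A' q) True \<le> adv_bgs U W p l \<beta> q"
proof -
  define J where "J = p \<bind> (\<lambda>(u, w). map_pmf (\<lambda>b. ((u, b), w)) (pmf_of_set (\<beta> (u, w))))"
  have fin: "finite (buckets l)"
    using finite_lists_length_eq[of "UNIV :: bool set" l] by (simp add: buckets_def)
  have J: "u \<in> U \<and> b \<in> buckets l" if "((u, b), w) \<in> set_pmf J" for u b w
  proof -
    have w: "(u, w) \<in> set_pmf p" "b \<in> set_pmf (pmf_of_set (\<beta> (u, w)))"
      using that by (auto simp: J_def)
    then have "\<beta> (u, w) \<noteq> {}" "\<beta> (u, w) \<subseteq> buckets l" "u \<in> U"
      using assms by (auto simp: bucketizing_def)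
    then show ?thesis using w(2) fin by (auto simp: set_pmf_of_set finite_subset)
  qed
  have eq: "BucketGuess p \<beta> A q =
      J \<bind> (\<lambda>(x, w). (case x of (u, b) \<Rightarrow> A u b q) \<bind> (\<lambda>S. return_pmf (w \<in> S)))" for A
    by (simp add: BucketGuess_def J_def bind_assoc_pmf case_prod_unfold bind_map_pmf)
  obtain B where B1: "\<forall>x q. B x q \<in> guess_sets W q" and
    B2: "\<forall>A q. (\<forall>x w. (x, w) \<in> set_pmf J \<longrightarrow> set_pmf (A x) \<subseteq> guess_sets W q) \<longrightarrow>
       pmf (J \<bind> (\<lambda>(x, w). A x \<bind> (\<lambda>S. return_pmf (w \<in> S)))) True
       \<le> pmf (J \<bind> (\<lambda>(x, w). return_pmf (w \<in> B x q))) True"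
    using best_strategy[of W J] by (elim exE conjE) (rule that)
  note B = B1 B2[THEN spec, THEN spec, THEN mp]
  let ?A = "\<lambda>u b q. return_pmf (B (u, b) q)"
  have A: "bguess_adversary U W l ?A" using B(1) by (auto simp: bguess_adversary_def)
  have le: "pmf (BucketGuess p \<beta> A' q) True \<le> pmf (BucketGuess p \<beta> ?A q) True"
    if A': "bguess_adversary U W l A'" for A'
  proof -
    have "\<forall>x w. (x, w) \<in> set_pmf J \<longrightarrow>
        set_pmf (case x of (u, b) \<Rightarrow> A' u b q) \<subseteq> guess_sets W q"
    proof (intro allI impI)
      fix x w assume "(x, w) \<in> set_pmf J"
      then show "set_pmf (case x of (u, b) \<Rightarrow> A' u b q) \<subseteq> guess_sets W q"
        using J[of "fst x" "snd x" w] A' by (simp add: bguess_adversary_def case_prod_beta)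
    qed
    from B(2)[of "\<lambda>x. case x of (u, b) \<Rightarrow> A' u b q" q, OF this] show ?thesis
      by (simp add: eq bind_return_pmf case_prod_beta)
  qed
  have "adv_bgs U W p l \<beta> q = pmf (BucketGuess p \<beta> ?A q) True"
    unfolding adv_bgs_def by (rule Greatest_attained) (use A le in auto)
  then show thesis using that A le by metis
qed

end

(* The IDB bucket is a function of the username, which the adversary sees anyway. Simulating the
   bucket in one direction and ignoring it in the other, the two games have the same set of
   achievable success probabilities, hence the same maximum. *)
theory Submission
  imports Defs
begin

text \<open>A uniform draw from a singleton is deterministic, so the bucket can be computed from
  \<open>u\<close>.\<close>

lemma BucketGuess_IDB:
  "BucketGuess p (IDB H l) A q = Guess p (\<lambda>u. A u (hash_prefix H l u)) q"
  by (simp add: BucketGuess_def Guess_def IDB_def pmf_of_set_singleton bind_return_pmf)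

text \<open>As \<open>l \<le> ell\<close>, truncation yields exactly \<open>l\<close> bits, so the
  simulated bucket lies in \<open>buckets l\<close>, where the bound on \<open>A\<close>
  applies.\<close>

lemma bguess_adversary_simulate_IDB:
  assumes "bguess_adversary U W l A" "\<forall>x. length (H x) = ell" "l \<le> ell"
  shows "guess_adversary U W (\<lambda>u. A u (hash_prefix H l u))"
  using assms by (simp add: bguess_adversary_def guess_adversary_def hash_prefix_def buckets_def)

lemma guess_adversary_ignore_bucket:
  assumes "guess_adversary U W A"
  shows "bguess_adversary U W l (\<lambda>u b. A u)"
  using assms by (simp add: bguess_adversary_def guess_adversary_def)

theorem theorem4p2:
  fixes U :: "bits set" and W :: "'w set" and p :: "'w cred pmf"
    and H :: "bits \<Rightarrow> bits" and ell l :: nat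
  assumes "set_pmf p \<subseteq> U \<times> W"
    and "\<forall>x. length (H x) = ell"
    and "l \<le> ell"
  shows "\<forall>q. adv_bgs U W p l (IDB H l) q = adv_gs U W p q"
proof
  fix q
  \<comment> \<open>Equivalence for every \<open>x\<close> makes the predicates under the two
    \<open>GREATEST\<close> operators equal.\<close>
  have "(\<exists>A. bguess_adversary U W l A \<and> x = pmf (BucketGuess p (IDB H l) A q) True) \<longleftrightarrow>
      (\<exists>A. guess_adversary U W A \<and> x = pmf (Guess p A q) True)" (is "?B \<longleftrightarrow> ?G") for x
  proof
    assume ?B
    then show ?G
      using bguess_adversary_simulate_IDB[OF _ assms(2,3)] by (auto simp: BucketGuess_IDB)
  next
    assume ?G
    then obtain A where "guess_adversary U W A" "x = pmf (Guess p A q) True" by blast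
    then show ?B
      by (intro exI[of _ "\<lambda>u b. A u"]) (simp add: guess_adversary_ignore_bucket BucketGuess_IDB)
  qed
  then show "adv_bgs U W p l (IDB H l) q = adv_gs U W p q"
    by (simp add: adv_bgs_def adv_gs_def)
qed

end
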